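(* Let $\varrho$ be a three qubit state with X-part $X(a,b,c)$, and let $\{i_1,i_2\}\cup\{i_3,i_4\}=\{1,2,3,4\}$ be a partition. Suppose that the triangle with two sides of lengths $|c_{i_1}|+|c_{i_2}|$ and $|c_{i_3}|+|c_{i_4}|$ and with internal angle $|\phi_c/2|$ between them is acute. If $\varrho$ is separable, then $$\Delta_\varrho\ge R,$$ where $R$ is the radius of the circumscribed circle of this triangle.
   Context: For $a,b\in\mathbb R^4$ and $c\in\mathbb C^4$, $X(a,b,c)$ denotes the $8\times 8$ self-adjoint matrix, regarded as an element of $M_2\otimes M_2\otimes M_2$ (complex $2\times 2$ matrices, basis indices $000,001,\dots,111$ in lexicographic order), whose diagonal is $(a_1,a_2,a_3,a_4,b_4,b_3,b_2,b_1)$, whose anti-diagonal entries, read from the top-right corner to the bottom-left corner, are $(c_1,c_2,c_3,c_4,\bar c_4,\bar c_3,\bar c_2,\bar c_1)$, and all of whose other entries are zero. A three qubit state is a positive semidefinite matrix in $M_2\otimes M_2\otimes M_2$ (normalization disregarded). The X-part of an $8\times8$ matrix is obtained by replacing by zero all entries that are neither diagonal nor anti-diagonal. A state is separable if it is a sum of pure product states, i.e. of rank one projections, up to positive scalars, onto product vectors $x\otimes y\otimes w$ with $x,y,w\in\mathbb C^2$. For a state $\varrho$ with X-part $X(a,b,c)$, $$\Delta_\varrho=\min\{\sqrt{a_1b_1},\sqrt{a_2b_2},\sqrt{a_3b_3},\sqrt{a_4b_4},\sqrt[4]{a_1b_2b_3a_4},\sqrt[4]{b_1a_2a_3b_4}\}.$$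 Writing $c_j=|c_j|e^{\mathrm i\theta_j}$, the phase difference is $\phi_c=(\theta_1+\theta_4)-(\theta_2+\theta_3)$ mod $2\pi$, taken here with its representative in $(-\pi,\pi]$ (if some $c_j=0$, any $\theta_j$ may be chosen). The triangle is understood to be non-degenerate, and acute means that all three angles are less than $\pi/2$. *)

theory Defs
  imports "HOL-Analysis.Analysis"
begin

text \<open>
  The basis of the threefold tensor product of \<open>\<complex>\<^sup>2\<close> is indexed by triples of bits: the numeral
  type \<^typ>\<open>2\<close> has exactly the elements \<open>0\<close> and \<open>1\<close>, and \<open>(i, j, k)\<close> stands for the label \<open>ijk\<close>.
  The lexicographic order \<open>000, 001, \<dots>, 111\<close> only enters through \<open>bit_slot\<close> below.
  Vectors of type \<^typ>\<open>real^4\<close> and \<^typ>\<open>complex^4\<close> have the components \<open>1, 2, 3, 4\<close>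
  (in the type \<^typ>\<open>4\<close> the index \<open>4\<close> coincides with \<open>0\<close>).
\<close>

type_synonym qubit3 = "2 \<times> 2 \<times> 2"

type_synonym vec3q = "complex^qubit3"

type_synonym mat3q = "complex^qubit3^qubit3"

definition product_vector :: "complex^2 \<Rightarrow> complex^2 \<Rightarrow> complex^2 \<Rightarrow> vec3q" where
  "product_vector x y w = vec_lambda (\<lambda>(i, j, k). x $ i * y $ j * w $ k)"

definition hermitian_inner :: "complex^'n \<Rightarrow> complex^'n \<Rightarrow> complex" where
  "hermitian_inner u v = (\<Sum>i\<in>UNIV. cnj (u $ i) * v $ i)"

definition self_adjoint :: "complex^'n^'n \<Rightarrow> bool" where
  "self_adjoint A \<longleftrightarrow> (\<forall>i j. A $ i $ j = cnj (A $ j $ i))"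

definition positive_semidefinite :: "complex^'n^'n \<Rightarrow> bool" where
  "positive_semidefinite A \<longleftrightarrow>
     self_adjoint A \<and> (\<forall>v. 0 \<le> Re (hermitian_inner v (A *v v)))"

definition three_qubit_state :: "mat3q \<Rightarrow> bool" where
  "three_qubit_state \<rho> \<longleftrightarrow> positive_semidefinite \<rho>"

text \<open>The orthogonal projection onto the line spanned by \<open>v\<close>, for \<open>v \<noteq> 0\<close>.\<close>

definition rank_one_projection :: "complex^'n \<Rightarrow> complex^'n^'n" where
  "rank_one_projection v = (\<chi> i j. v $ i * cnj (v $ j) / complex_of_real ((norm v)\<^sup>2))"

definition pure_product_state :: "mat3q \<Rightarrow> bool" where
  "pure_product_state \<rho> \<longleftrightarrow>
     (\<exists>r::real. \<exists>x y w. r > 0 \<and> product_vector x y w \<noteq> 0 \<and>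
        \<rho> = r *\<^sub>R rank_one_projection (product_vector x y w))"

definition separable_state :: "mat3q \<Rightarrow> bool" where
  "separable_state \<rho> \<longleftrightarrow>
     (\<exists>(n::nat) \<sigma>. (\<forall>k<n. pure_product_state (\<sigma> k)) \<and> \<rho> = (\<Sum>k<n. \<sigma> k))"

text \<open>
  Flipping all three bits reverses the lexicographic order, so the anti-diagonal consists of the
  positions \<open>(p, flip_bits p)\<close>, and \<open>000, 001, 010, 011\<close> index the upper half of the matrix.
\<close>

definition flip_bits :: "qubit3 \<Rightarrow> qubit3" where
  "flip_bits = (\<lambda>(i, j, k). (1 - i, 1 - j, 1 - k))"

definition bit_slot :: "qubit3 \<Rightarrow> 4" where
  "bit_slot p =
     (if p \<in> {(0, 0, 0), (1, 1, 1)} then 1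
      else if p \<in> {(0, 0, 1), (1, 1, 0)} then 2
      else if p \<in> {(0, 1, 0), (1, 0, 1)} then 3
      else 4)"

definition X_matrix :: "real^4 \<Rightarrow> real^4 \<Rightarrow> complex^4 \<Rightarrow> mat3q" where
  "X_matrix a b c =
     (\<chi> p q.
        if q = p then
          complex_of_real (if fst p = 0 then a $ bit_slot p else b $ bit_slot p)
        else if q = flip_bits p then
          (if fst p = 0 then c $ bit_slot p else cnj (c $ bit_slot p))
        else 0)"

definition X_part :: "mat3q \<Rightarrow> mat3q" where
  "X_part \<rho> = (\<chi> p q. if q = p \<or> q = flip_bits p then \<rho> $ p $ q else 0)"

text \<open>The number \<open>\<Delta>\<^sub>\<rho>\<close> depends only on the diagonal \<open>a, b\<close> of the state \<open>\<rho>\<close>.\<close>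

definition Delta :: "real^4 \<Rightarrow> real^4 \<Rightarrow> real" where
  "Delta a b = Min
     {sqrt (a $ 1 * b $ 1), sqrt (a $ 2 * b $ 2), sqrt (a $ 3 * b $ 3), sqrt (a $ 4 * b $ 4),
      root 4 (a $ 1 * b $ 2 * b $ 3 * a $ 4), root 4 (b $ 1 * a $ 2 * a $ 3 * b $ 4)}"

text \<open>
  A relation rather than a function: when some \<open>c $ j = 0\<close>, the angle \<open>\<theta> $ j\<close> is arbitrary,
  and then every number in \<open>(-\<pi>, \<pi>]\<close> is a phase difference of \<open>c\<close>.
\<close>

definition phase_difference :: "complex^4 \<Rightarrow> real \<Rightarrow> bool" where
  "phase_difference c \<phi> \<longleftrightarrow>
     - pi < \<phi> \<and> \<phi> \<le> pi \<and>
     (\<exists>\<theta>::real^4. (\<forall>j. c $ j = rcis (cmod (c $ j)) (\<theta> $ j)) \<and>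
        (\<exists>m::int. \<phi> = (\<theta> $ 1 + \<theta> $ 4) - (\<theta> $ 2 + \<theta> $ 3) + 2 * pi * of_int m))"

text \<open>The internal angle at the vertex \<open>Q\<close>, meaningful when \<open>P \<noteq> Q\<close> and \<open>S \<noteq> Q\<close>.\<close>

definition angle_at :: "real^2 \<Rightarrow> real^2 \<Rightarrow> real^2 \<Rightarrow> real" where
  "angle_at P Q S = arccos (((P - Q) \<bullet> (S - Q)) / (norm (P - Q) * norm (S - Q)))"

definition nondegenerate_triangle :: "real^2 \<Rightarrow> real^2 \<Rightarrow> real^2 \<Rightarrow> bool" where
  "nondegenerate_triangle P Q S \<longleftrightarrow> \<not> collinear {P, Q, S}"

definition acute_triangle :: "real^2 \<Rightarrow> real^2 \<Rightarrow> real^2 \<Rightarrow> bool" where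
  "acute_triangle P Q S \<longleftrightarrow>
     nondegenerate_triangle P Q S \<and>
     angle_at Q P S < pi / 2 \<and> angle_at P Q S < pi / 2 \<and> angle_at P S Q < pi / 2"

definition circumscribed_circle :: "real^2 \<Rightarrow> real \<Rightarrow> real^2 \<Rightarrow> real^2 \<Rightarrow> real^2 \<Rightarrow> bool" where
  "circumscribed_circle M R P Q S \<longleftrightarrow> {P, Q, S} \<subseteq> sphere M R"

end

theory Submission
  imports Defs
begin

text \<open>
  A pure product state has four anti-diagonal entries of one common modulus \<open>h\<close> and of phase
  difference \<open>0\<close>, and its \<open>\<Delta>\<close> equals \<open>h\<close>. By Cauchy--Schwarz \<open>\<Delta>\<close> is superadditive, so it suffices
  to show that \<open>\<Sum>h \<ge> R\<close> for every decomposition of \<open>\<rho>\<close>. This is linear duality: evaluating the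
  functional \<open>cos \<angle>Q \<cdot> (|c\<^sub>i\<^sub>1| + |c\<^sub>i\<^sub>2|) + cos \<angle>S \<cdot> (|c\<^sub>i\<^sub>3| + |c\<^sub>i\<^sub>4|)\<close>, whose coefficients are
  nonnegative because the triangle is acute, on the phases of one summand gives at most
  \<open>2 h sin \<bar>\<phi>/2\<bar>\<close>, whereas on \<open>c\<close> it gives the third side \<open>2 R sin \<bar>\<phi>/2\<bar>\<close>.
\<close>

section \<open>Trigonometric bound on the dual functional for one summand\<close>

text \<open>Sum-to-product reduces the left side to \<open>2 * (l * |cos p| + m * |cos q|)\<close>,
  where p and q are the mean angles of the pairs and \<open>|cos (p - q)| = k\<close> by the double
  angle formula. Up to signs the bracket is the real part of l cis(p) + m cis(q) or l cis(p) - m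
  cis(q), and N bounds both moduli.\<close>

lemma cos_pairs_bound:
  fixes s t u v l m k N :: real
  assumes "l \<ge> 0" "m \<ge> 0" "k \<ge> 0" "N \<ge> 0"
    and N: "N\<^sup>2 = l\<^sup>2 + m\<^sup>2 + 2 * l * m * k"
    and k: "cos (s + t - u - v) = 2 * k\<^sup>2 - 1"
  shows "l * (cos s + cos t) + m * (cos u + cos v) \<le> 2 * N"
proof -
  define p q where "p = (s + t) / 2" and "q = (u + v) / 2"
  have st: "cos s + cos t = 2 * (cos p * cos ((s - t) / 2))"
    unfolding p_def by (simp add: cos_plus_cos)
  have uv: "cos u + cos v = 2 * (cos q * cos ((u - v) / 2))"
    unfolding q_def by (simp add: cos_plus_cos)
  have le: "x * cos y \<le> \<bar>x\<bar>" for x y :: real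
  proof -
    have "x * cos y \<le> \<bar>x\<bar> * \<bar>cos y\<bar>"
      by (metis abs_ge_self abs_mult)
    also have "\<dots> \<le> \<bar>x\<bar>"
      by (simp add: mult_left_le)
    finally show ?thesis .
  qed
  have "(s + t - u - v) = 2 * (p - q)"
    by (simp add: p_def q_def field_simps)
  then have "(cos (p - q))\<^sup>2 = k\<^sup>2"
    using k cos_double_cos[of "p - q"] by simp
  then have ck: "\<bar>cos (p - q)\<bar> = k"
    using \<open>k \<ge> 0\<close> by (metis abs_of_nonneg power2_eq_iff_nonneg abs_ge_zero power2_abs)
  have "\<bar>cos p * cos q\<bar> \<le> k + \<bar>sin p\<bar> * \<bar>sin q\<bar>"
    using ck by (simp add: cos_diff flip: abs_mult)
  then have "2 * (l * m) * (\<bar>cos p\<bar> * \<bar>cos q\<bar>) \<le> 2 * (l * m) * (k + \<bar>sin p\<bar> * \<bar>sin q\<bar>)"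
    using assms by (intro mult_left_mono) (auto simp: abs_mult)
  \<comment> \<open>Completing the square: this term absorbs the product of sines introduced by the
    previous inequality.\<close>
  moreover have "0 \<le> (l * \<bar>sin p\<bar> - m * \<bar>sin q\<bar>)\<^sup>2"
    by simp
  moreover have "l\<^sup>2 * (cos p)\<^sup>2 = l\<^sup>2 - l\<^sup>2 * (sin p)\<^sup>2" "m\<^sup>2 * (cos q)\<^sup>2 = m\<^sup>2 - m\<^sup>2 * (sin q)\<^sup>2"
    by (simp_all add: cos_squared_eq algebra_simps)
  ultimately have "(l * \<bar>cos p\<bar> + m * \<bar>cos q\<bar>)\<^sup>2 \<le> N\<^sup>2"
    unfolding N by (simp add: power2_sum power2_diff power_mult_distrib algebra_simps)
  then have "l * \<bar>cos p\<bar> + m * \<bar>cos q\<bar> \<le> N"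
    using \<open>N \<ge> 0\<close> power2_le_imp_le by blast
  moreover have "l * (cos p * cos ((s - t) / 2)) \<le> l * \<bar>cos p\<bar>"
    "m * (cos q * cos ((u - v) / 2)) \<le> m * \<bar>cos q\<bar>"
    using assms le by (auto intro!: mult_left_mono)
  ultimately show ?thesis
    unfolding st uv by (simp add: algebra_simps)
qed

text \<open>Cosine is even, so each partition into pairs reduces to \<open>cos_pairs_bound\<close>:
  negating \<open>e 2\<close> and \<open>e 4\<close>, or \<open>e 3\<close> and \<open>e 4\<close>,
  turns the difference of pair sums into the phase difference
  \<open>e 1 + e 4 - e 2 - e 3\<close>.\<close>

lemma cos_partition_bound:
  fixes e :: "4 \<Rightarrow> real"
  assumes "l \<ge> 0" "m \<ge> 0" "k \<ge> 0" "N \<ge> 0"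
    and N: "N\<^sup>2 = l\<^sup>2 + m\<^sup>2 + 2 * l * m * k"
    and k: "cos (e 1 + e 4 - e 2 - e 3) = 2 * k\<^sup>2 - 1"
    and part: "{i1, i2} \<union> {i3, i4} = {1, 2, 3, 4}"
  shows "l * (cos (e i1) + cos (e i2)) + m * (cos (e i3) + cos (e i4)) \<le> 2 * N"
proof -
  have N': "N\<^sup>2 = m\<^sup>2 + l\<^sup>2 + 2 * m * l * k"
    using N by simp
  note bound = cos_pairs_bound[OF assms(1-4) N] cos_pairs_bound[OF assms(2,1,3,4) N']
  have k': "cos (- (e 1 + e 4 - e 2 - e 3)) = 2 * k\<^sup>2 - 1"
    by (subst cos_minus) (rule k)
  have b: "l * (cos (e 1) + cos (e 4)) + m * (cos (e 2) + cos (e 3)) \<le> 2 * N"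
    "m * (cos (e 1) + cos (e 4)) + l * (cos (e 2) + cos (e 3)) \<le> 2 * N"
    "l * (cos (e 1) + cos (- e 2)) + m * (cos (e 3) + cos (- e 4)) \<le> 2 * N"
    "m * (cos (e 1) + cos (- e 2)) + l * (cos (e 3) + cos (- e 4)) \<le> 2 * N"
    "l * (cos (e 1) + cos (- e 3)) + m * (cos (e 2) + cos (- e 4)) \<le> 2 * N"
    "m * (cos (e 1) + cos (- e 3)) + l * (cos (e 2) + cos (- e 4)) \<le> 2 * N"
    using k k' by (intro bound; simp add: algebra_simps)+
  \<comment> \<open>Four indices covering four values form a permutation. Up to order within the
    pairs the 24 permutations give the six inequalities above.\<close>
  have "1 \<in> {i1, i2, i3, i4}" "2 \<in> {i1, i2, i3, i4}" "3 \<in> {i1, i2, i3, i4}" "4 \<in> {i1, i2, i3, i4}"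
    using part by auto
  then show ?thesis
    using b exhaust_4[of i1] exhaust_4[of i2] exhaust_4[of i3] exhaust_4[of i4]
    by (elim disjE; simp add: add.commute)
qed

section \<open>Superadditivity of geometric means\<close>

lemma sum_sqrt_mult_le:
  fixes f g :: "'i \<Rightarrow> real"
  assumes "\<And>i. i \<in> A \<Longrightarrow> 0 \<le> f i" "\<And>i. i \<in> A \<Longrightarrow> 0 \<le> g i"
  shows "(\<Sum>i\<in>A. sqrt (f i * g i)) \<le> sqrt (sum f A * sum g A)"
proof -
  have "(\<Sum>i\<in>A. sqrt (f i) * sqrt (g i))\<^sup>2 \<le> (\<Sum>i\<in>A. (sqrt (f i))\<^sup>2) * (\<Sum>i\<in>A. (sqrt (g i))\<^sup>2)"
    by (rule Cauchy_Schwarz_ineq_sum)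
  also have "\<dots> = sum f A * sum g A"
    using assms by simp
  finally show ?thesis
    by (simp add: real_le_rsqrt flip: real_sqrt_mult)
qed

text \<open>A fourth root of a product is a geometric mean of two geometric means, so Cauchy-Schwarz
  applies once outside and then to each inner pair.\<close>

lemma sum_root4_le:
  fixes f g u v :: "'i \<Rightarrow> real"
  assumes "\<And>i. i \<in> A \<Longrightarrow> 0 \<le> f i" "\<And>i. i \<in> A \<Longrightarrow> 0 \<le> g i"
    and "\<And>i. i \<in> A \<Longrightarrow> 0 \<le> u i" "\<And>i. i \<in> A \<Longrightarrow> 0 \<le> v i"
    and h: "\<And>i. i \<in> A \<Longrightarrow> 0 \<le> h i" "\<And>i. i \<in> A \<Longrightarrow> f i * g i * u i * v i = h i ^ 4"
  shows "sum h A \<le> root 4 (sum f A * sum g A * sum u A * sum v A)"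
proof -
  have "sum h A = (\<Sum>i\<in>A. sqrt (sqrt (f i * g i) * sqrt (u i * v i)))"
  proof (rule sum.cong[OF refl])
    fix i assume i: "i \<in> A"
    have "sqrt (f i * g i) * sqrt (u i * v i) = sqrt (((h i)\<^sup>2)\<^sup>2)"
      using h(2)[OF i] by (simp add: mult.assoc flip: real_sqrt_mult power_mult)
    also have "\<dots> = (h i)\<^sup>2"
      by (rule real_sqrt_unique) simp_all
    finally show "h i = sqrt (sqrt (f i * g i) * sqrt (u i * v i))"
      using h(1)[OF i] by simp
  qed
  also have "\<dots> \<le> sqrt ((\<Sum>i\<in>A. sqrt (f i * g i)) * (\<Sum>i\<in>A. sqrt (u i * v i)))"
    using assms by (intro sum_sqrt_mult_le) auto
  also have "\<dots> \<le> sqrt (sqrt (sum f A * sum g A) * sqrt (sum u A * sum v A))"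
    using assms by (intro real_sqrt_le_mono mult_mono sum_sqrt_mult_le)
      (auto intro!: sum_nonneg mult_nonneg_nonneg)
  also have "\<dots> = root 4 (sum f A * sum g A * sum u A * sum v A)"
    using real_root_mult_exp[of 2 2] by (simp add: sqrt_def real_root_mult mult.assoc)
  finally show ?thesis .
qed

section \<open>Matrix entries of pure product states\<close>

text \<open>The angles \<alpha>, \<beta>, \<gamma> stand for the relative phases of the two
  components in each tensor factor. The last two products are those under the fourth roots in
  \<open>Delta\<close>.\<close>

definition product_entries :: "mat3q \<Rightarrow> real \<Rightarrow> real \<Rightarrow> real \<Rightarrow> real \<Rightarrow> bool" where
  "product_entries \<sigma> h \<alpha> \<beta> \<gamma> \<longleftrightarrow> h \<ge> 0
    \<and> \<sigma> $ (0,0,0) $ (1,1,1) = rcis h (\<alpha> + \<beta> + \<gamma>)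
    \<and> \<sigma> $ (0,0,1) $ (1,1,0) = rcis h (\<alpha> + \<beta> - \<gamma>)
    \<and> \<sigma> $ (0,1,0) $ (1,0,1) = rcis h (\<alpha> - \<beta> + \<gamma>)
    \<and> \<sigma> $ (0,1,1) $ (1,0,0) = rcis h (\<alpha> - \<beta> - \<gamma>)
    \<and> (\<forall>p. 0 \<le> Re (\<sigma> $ p $ p))
    \<and> (\<forall>p. Re (\<sigma> $ p $ p) * Re (\<sigma> $ flip_bits p $ flip_bits p) = h\<^sup>2)
    \<and> Re (\<sigma> $ (0,0,0) $ (0,0,0)) * Re (\<sigma> $ (1,1,0) $ (1,1,0)) *
         Re (\<sigma> $ (1,0,1) $ (1,0,1)) * Re (\<sigma> $ (0,1,1) $ (0,1,1)) = h ^ 4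
    \<and> Re (\<sigma> $ (1,1,1) $ (1,1,1)) * Re (\<sigma> $ (0,0,1) $ (0,0,1)) *
         Re (\<sigma> $ (0,1,0) $ (0,1,0)) * Re (\<sigma> $ (1,0,0) $ (1,0,0)) = h ^ 4"

text \<open>Positions p and \<open>flip_bits p\<close> together involve both components of every
  factor, which gives one common modulus; exchanging the two bits of a factor reverses the sign of
  its phase. In each fourfold product every bit takes the values 0 and 1 twice.\<close>

lemma pure_product_state_entries:
  assumes "pure_product_state \<sigma>"
  shows "\<exists>h \<alpha> \<beta> \<gamma>. product_entries \<sigma> h \<alpha> \<beta> \<gamma>"
proof -
  obtain r x y w where r: "r > 0"
    and \<sigma>: "\<sigma> = r *\<^sub>R rank_one_projection (product_vector x y w)"
    using assms unfolding pure_product_state_def by blast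
  define t where "t = r / (norm (product_vector x y w))\<^sup>2"
  have t: "t \<ge> 0"
    using r by (simp add: t_def)
  have entry: "\<sigma> $ (i, j, k) $ (i', j', k') =
      of_real t * (x $ i * y $ j * w $ k) * cnj (x $ i' * y $ j' * w $ k')" for i j k i' j' k'
    by (simp add: \<sigma> t_def rank_one_projection_def product_vector_def
        scaleR_conv_of_real[of _ "_ :: complex"])
  have diag: "Re (\<sigma> $ (i, j, k) $ (i, j, k)) =
      t * (cmod (x $ i))\<^sup>2 * (cmod (y $ j))\<^sup>2 * (cmod (w $ k))\<^sup>2" for i j k
  proof -
    have "\<sigma> $ (i, j, k) $ (i, j, k) =
        of_real (t * (cmod (x $ i))\<^sup>2 * (cmod (y $ j))\<^sup>2 * (cmod (w $ k))\<^sup>2)"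
      unfolding entry by (simp add: complex_norm_square[unfolded of_real_power] mult_ac)
    then show ?thesis
      by simp
  qed
  define h where "h = t * (cmod (x $ 0) * cmod (x $ 1)) * (cmod (y $ 0) * cmod (y $ 1))
    * (cmod (w $ 0) * cmod (w $ 1))"
  \<comment> \<open>A vanishing component does no harm: \<open>Arg 0\<close> has a default value,
    and \<open>h\<close> is then 0.\<close>
  define \<alpha> \<beta> \<gamma> where "\<alpha> = Arg (x $ 0) - Arg (x $ 1)" and "\<beta> = Arg (y $ 0) - Arg (y $ 1)"
    and "\<gamma> = Arg (w $ 0) - Arg (w $ 1)"
  note defs = h_def \<alpha>_def \<beta>_def \<gamma>_def
  have polar: "z = rcis (cmod z) (Arg z)" for z
    by (simp add: rcis_cmod_Arg)
  have cnj_polar: "cnj z = rcis (cmod z) (- Arg z)" for z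
    by (metis polar rcis_cnj)
  have t_polar: "of_real t = rcis t 0"
    by simp
  have offdiag: "\<sigma> $ (i, j, k) $ (i', j', k') =
      rcis (t * (cmod (x $ i) * cmod (x $ i')) * (cmod (y $ j) * cmod (y $ j')) * (cmod (w $ k) * cmod (w $ k')))
       ((Arg (x $ i) - Arg (x $ i')) + (Arg (y $ j) - Arg (y $ j')) + (Arg (w $ k) - Arg (w $ k')))"
    for i j k i' j' k'
    unfolding entry complex_cnj_mult t_polar
    by (subst polar[of "x $ i"], subst polar[of "y $ j"], subst polar[of "w $ k"],
        subst cnj_polar[of "x $ i'"], subst cnj_polar[of "y $ j'"], subst cnj_polar[of "w $ k'"])
      (simp only: rcis_mult, simp add: algebra_simps)
  have two: "i = 0 \<or> i = 1" for i :: 2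
    using exhaust_2[of i] by auto
  have "0 \<le> Re (\<sigma> $ p $ p)" for p
    using t by (cases p) (simp add: diag)
  moreover have "Re (\<sigma> $ p $ p) * Re (\<sigma> $ flip_bits p $ flip_bits p) = h\<^sup>2" for p
  proof (cases p)
    case (fields i j k)
    then show ?thesis
      using two[of i] two[of j] two[of k]
      by (elim disjE; simp add: flip_bits_def diag h_def power2_eq_square)
  qed
  ultimately have "product_entries \<sigma> h \<alpha> \<beta> \<gamma>"
    unfolding product_entries_def using t
    by (simp add: offdiag diag, simp add: defs algebra_simps power2_eq_square power4_eq_xxxx)
  then show ?thesis
    by blast
qed

section \<open>Triangle geometry and the dual coefficients\<close>

lemma cos_angle_at:
  "cos (angle_at P Q S) = ((P - Q) \<bullet> (S - Q)) / (norm (P - Q) * norm (S - Q))"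
  and angle_at_nonneg: "angle_at P Q S \<ge> 0"
proof -
  have "\<bar>(P - Q) \<bullet> (S - Q)\<bar> \<le> norm (P - Q) * norm (S - Q)"
    by (rule Cauchy_Schwarz_ineq2)
  \<comment> \<open>If a side vanishes, the quotient is 0 by the convention for division by
    zero.\<close>
  then have le: "\<bar>((P - Q) \<bullet> (S - Q)) / (norm (P - Q) * norm (S - Q))\<bar> \<le> 1"
    by (auto simp: divide_le_eq_1 zero_less_mult_iff)
  show "cos (angle_at P Q S) = ((P - Q) \<bullet> (S - Q)) / (norm (P - Q) * norm (S - Q))"
    unfolding angle_at_def using le by (rule cos_arccos_abs)
  show "angle_at P Q S \<ge> 0"
    unfolding angle_at_def using le by (intro arccos_lbound) (simp_all only: abs_le_iff, linarith)
qed

lemma inner_pos_of_acute: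
  assumes "angle_at P Q S < pi / 2"
  shows "(P - Q) \<bullet> (S - Q) > 0"
proof -
  have "cos (angle_at P Q S) > 0"
    using assms angle_at_nonneg[of P Q S] by (intro cos_gt_zero_pi) auto
  then show ?thesis
    unfolding cos_angle_at zero_less_divide_iff by (auto simp: mult_less_0_iff)
qed

text \<open>
  The coefficients \<open>l\<close> and \<open>m\<close> are \<open>cos \<angle>Q\<close> and \<open>cos \<angle>S\<close>, and \<open>N = sin \<angle>P\<close>, all scaled by the
  product of the three side lengths.
\<close>

lemma acute_triangle_dual:
  assumes "acute_triangle P Q S" "circumscribed_circle M R P Q S"
  obtains l m N where "l \<ge> 0" "m \<ge> 0" "N > 0" "cos (angle_at Q P S) \<ge> 0"
    and "N\<^sup>2 = l\<^sup>2 + m\<^sup>2 + 2 * l * m * cos (angle_at Q P S)"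
    and "l * dist P Q + m * dist P S = 2 * N * R"
proof -
  define p s where "p = Q - P" and "s = S - P"
  \<comment> \<open>These are the Gram entries of the two sides at P; \<open>D\<close> below is
    twice the area of the triangle.\<close>
  define a b t where "a = p \<bullet> p" and "b = s \<bullet> s" and "t = p \<bullet> s"
  define A B C D where "A = norm p" and "B = norm s" and "C = norm (S - Q)"
    and "D = \<bar>p $ 1 * s $ 2 - p $ 2 * s $ 1\<bar>"
  have nd: "\<not> collinear {P, Q, S}" and acute: "angle_at Q P S < pi / 2"
    "angle_at P Q S < pi / 2" "angle_at P S Q < pi / 2"
    using assms(1) by (auto simp: acute_triangle_def nondegenerate_triangle_def)
  have "P \<noteq> Q" "P \<noteq> S" "Q \<noteq> S"
    using nd by (auto simp: insert_commute)
  then have pos: "A > 0" "B > 0" "C > 0"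
    by (auto simp: A_def B_def C_def p_def s_def)
  have sq: "A\<^sup>2 = a" "B\<^sup>2 = b" "C\<^sup>2 = a + b - 2 * t"
    unfolding A_def B_def C_def a_def b_def t_def p_def s_def power2_norm_eq_inner
    by (simp_all add: inner_diff inner_commute)
  have t: "t > 0"
    using inner_pos_of_acute[OF acute(1)] by (simp add: t_def p_def s_def)
  have at: "a - t > 0"
    using inner_pos_of_acute[OF acute(2)]
    by (simp add: a_def t_def p_def s_def inner_diff inner_commute algebra_simps)
  have bt: "b - t > 0"
    using inner_pos_of_acute[OF acute(3)]
    by (simp add: b_def t_def p_def s_def inner_diff inner_commute algebra_simps)
  \<comment> \<open>Lagrange's identity: \<open>D\<close> squared is the Gram determinant.\<close>
  have D2: "D\<^sup>2 = a * b - t\<^sup>2"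
    unfolding D_def a_def b_def t_def
    by (simp add: inner_vec_def sum_2 power2_abs) (simp add: power2_eq_square algebra_simps)
  have cos: "cos (angle_at Q P S) = t / (A * B)"
    unfolding cos_angle_at by (simp add: t_def A_def B_def p_def s_def)
  \<comment> \<open>Non-collinearity excludes equality in Cauchy-Schwarz, so \<open>D\<close> is
    nonzero.\<close>
  have "t \<noteq> A * B \<and> t \<noteq> - (A * B)"
  proof -
    have "\<not> collinear {0, p, s}"
      using nd collinear_3[of Q P S] by (simp add: p_def s_def insert_commute)
    then show ?thesis
      unfolding norm_cauchy_schwarz_equal[symmetric] t_def A_def B_def by auto
  qed
  then have "t\<^sup>2 \<noteq> (A * B)\<^sup>2"
    by (simp add: power2_eq_iff)
  then have "D \<noteq> 0"
    using D2 by (auto simp: power_mult_distrib sq)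
  then have D: "D > 0"
    by (simp add: D_def)
  have R: "dist M P = R" "dist M Q = R" "dist M S = R"
    using assms(2) by (auto simp: circumscribed_circle_def)
  define z where "z = M - P"
  have zR: "z \<bullet> z = R\<^sup>2"
    using R(1) by (simp add: z_def dist_norm flip: power2_norm_eq_inner)
  have "(z - p) \<bullet> (z - p) = R\<^sup>2" "(z - s) \<bullet> (z - s) = R\<^sup>2"
    using R(2,3) by (simp_all add: z_def p_def s_def dist_norm flip: power2_norm_eq_inner)
  then have zp: "z \<bullet> p = a / 2" "z \<bullet> s = b / 2"
    using zR by (simp_all add: a_def b_def inner_diff inner_commute)
  \<comment> \<open>The norm of z is recovered from its inner products with p and s through the
    adjugate of the Gram matrix.\<close>
  have "D\<^sup>2 * (z \<bullet> z) = (z \<bullet> p)\<^sup>2 * b + (z \<bullet> s)\<^sup>2 * a - 2 * (z \<bullet> p) * (z \<bullet> s) * t"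
    unfolding D_def a_def b_def t_def
    by (simp add: inner_vec_def sum_2 power2_abs) algebra
  also have "\<dots> = a * b * (a + b - 2 * t) / 4"
    unfolding zp by (simp add: power2_eq_square field_simps)
  finally have "(2 * D * R)\<^sup>2 = (A * B * C)\<^sup>2"
    unfolding zR by (simp add: power_mult_distrib sq)
  moreover have "R \<ge> 0"
    using R(1) by auto
  \<comment> \<open>The classical formula: the product of the sides is four times the area times the
    circumradius.\<close>
  ultimately have law: "2 * D * R = A * B * C"
    using D pos by - (rule power2_eq_imp_eq, simp_all)
  show thesis
  proof (rule that[of "(a - t) * B" "(b - t) * A" "D * C"])
    \<comment> \<open>Scaled form of sin^2 P = cos^2 Q + cos^2 S + 2 cos Q cos S cos P, valid for
      the angles of a triangle.\<close>
    show "(D * C)\<^sup>2 = ((a - t) * B)\<^sup>2 + ((b - t) * A)\<^sup>2 +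
        2 * ((a - t) * B) * ((b - t) * A) * cos (angle_at Q P S)"
    proof -
      have "2 * ((a - t) * B) * ((b - t) * A) * cos (angle_at Q P S) = 2 * (a - t) * (b - t) * t"
        using pos by (simp add: cos)
      then show ?thesis
        unfolding power_mult_distrib sq D2 by (simp add: power2_eq_square algebra_simps)
    qed
    \<comment> \<open>Projection formula: the side opposite P is the sum of the projections of the
      other two sides onto it.\<close>
    have "(a - t) * B * A + (b - t) * A * B = A * B * C\<^sup>2"
      unfolding sq by (simp add: algebra_simps)
    also have "\<dots> = 2 * (D * C) * R"
      using law by (simp add: power2_eq_square)
    finally show "(a - t) * B * dist P Q + (b - t) * A * dist P S = 2 * (D * C) * R"
      by (simp add: A_def B_def p_def s_def dist_norm norm_minus_commute)
  qed (use at bt t pos D in \<open>simp_all add: cos\<close>)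
qed

section \<open>Comparison of both sides with the total modulus of a product decomposition\<close>

theorem proposition5p3:
  fixes \<rho> :: mat3q
    and a b :: "real^4" and c :: "complex^4"
    and i1 i2 i3 i4 :: 4
    and \<phi> R :: real
    and P Q S M :: "real^2"
  assumes "three_qubit_state \<rho>"
    and "X_part \<rho> = X_matrix a b c"
    and "{i1, i2} \<union> {i3, i4} = {1, 2, 3, 4}"
    and "{i1, i2} \<inter> {i3, i4} = {}"
    and "phase_difference c \<phi>"
    and "dist P Q = cmod (c $ i1) + cmod (c $ i2)"
    and "dist P S = cmod (c $ i3) + cmod (c $ i4)"
    and "angle_at Q P S = \<bar>\<phi> / 2\<bar>"
    and "acute_triangle P Q S"
    and "circumscribed_circle M R P Q S"
    and "separable_state \<rho>"
  shows "Delta a b \<ge> R"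
proof -
  obtain n :: nat and \<sigma> where pure: "\<forall>k<n. pure_product_state (\<sigma> k)" and \<rho>: "\<rho> = (\<Sum>k<n. \<sigma> k)"
    using assms(11) unfolding separable_state_def by blast
  have "\<forall>k. \<exists>h \<alpha> \<beta> \<gamma>. k < n \<longrightarrow> product_entries (\<sigma> k) h \<alpha> \<beta> \<gamma>"
    using pure_product_state_entries pure by blast
  then obtain h \<alpha> \<beta> \<gamma> where "\<forall>k. k < n \<longrightarrow> product_entries (\<sigma> k) (h k) (\<alpha> k) (\<beta> k) (\<gamma> k)"
    unfolding choice_iff by blast
  then have h: "\<And>k. k < n \<Longrightarrow> h k \<ge> 0"
    and off: "\<And>k. k < n \<Longrightarrow> \<sigma> k $ (0,0,0) $ (1,1,1) = rcis (h k) (\<alpha> k + \<beta> k + \<gamma> k)"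
      "\<And>k. k < n \<Longrightarrow> \<sigma> k $ (0,0,1) $ (1,1,0) = rcis (h k) (\<alpha> k + \<beta> k - \<gamma> k)"
      "\<And>k. k < n \<Longrightarrow> \<sigma> k $ (0,1,0) $ (1,0,1) = rcis (h k) (\<alpha> k - \<beta> k + \<gamma> k)"
      "\<And>k. k < n \<Longrightarrow> \<sigma> k $ (0,1,1) $ (1,0,0) = rcis (h k) (\<alpha> k - \<beta> k - \<gamma> k)"
    and nonneg: "\<And>k p. k < n \<Longrightarrow> 0 \<le> Re (\<sigma> k $ p $ p)"
    and flip: "\<And>k p. k < n \<Longrightarrow> Re (\<sigma> k $ p $ p) * Re (\<sigma> k $ flip_bits p $ flip_bits p) = (h k)\<^sup>2"
    and four: "\<And>k. k < n \<Longrightarrow> Re (\<sigma> k $ (0,0,0) $ (0,0,0)) * Re (\<sigma> k $ (1,1,0) $ (1,1,0)) *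
         Re (\<sigma> k $ (1,0,1) $ (1,0,1)) * Re (\<sigma> k $ (0,1,1) $ (0,1,1)) = h k ^ 4"
      "\<And>k. k < n \<Longrightarrow> Re (\<sigma> k $ (1,1,1) $ (1,1,1)) * Re (\<sigma> k $ (0,0,1) $ (0,0,1)) *
         Re (\<sigma> k $ (0,1,0) $ (0,1,0)) * Re (\<sigma> k $ (1,0,0) $ (1,0,0)) = h k ^ 4"
    unfolding product_entries_def by blast+
  have \<rho>_entry: "\<rho> $ p $ q = (\<Sum>k<n. \<sigma> k $ p $ q)" for p q
    by (simp add: \<rho>)
  have X: "X_part \<rho> $ p $ q = X_matrix a b c $ p $ q" for p q
    using assms(2) by simp
  have diag: "Re (X_matrix a b c $ p $ p) = (\<Sum>k<n. Re (\<sigma> k $ p $ p))" for p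
    using arg_cong[OF X[of p p], of Re] by (simp add: X_part_def \<rho>_entry)
  have anti: "X_matrix a b c $ p $ flip_bits p = (\<Sum>k<n. \<sigma> k $ p $ flip_bits p)" for p
    using X[of p "flip_bits p"] by (simp add: X_part_def \<rho>_entry)
  have a_sum: "a $ 1 = (\<Sum>k<n. Re (\<sigma> k $ (0,0,0) $ (0,0,0)))"
    "a $ 2 = (\<Sum>k<n. Re (\<sigma> k $ (0,0,1) $ (0,0,1)))"
    "a $ 3 = (\<Sum>k<n. Re (\<sigma> k $ (0,1,0) $ (0,1,0)))"
    "a $ 4 = (\<Sum>k<n. Re (\<sigma> k $ (0,1,1) $ (0,1,1)))"
    by (simp_all add: X_matrix_def bit_slot_def flip: diag)
  have b_sum: "b $ 1 = (\<Sum>k<n. Re (\<sigma> k $ (1,1,1) $ (1,1,1)))"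
    "b $ 2 = (\<Sum>k<n. Re (\<sigma> k $ (1,1,0) $ (1,1,0)))"
    "b $ 3 = (\<Sum>k<n. Re (\<sigma> k $ (1,0,1) $ (1,0,1)))"
    "b $ 4 = (\<Sum>k<n. Re (\<sigma> k $ (1,0,0) $ (1,0,0)))"
    by (simp_all add: X_matrix_def bit_slot_def flip: diag)
  \<comment> \<open>\<open>H\<close> is the intermediate quantity:
    \<open>R \<le> H \<le> Delta a b\<close>.\<close>
  define H where "H = (\<Sum>k<n. h k)"
  have pair: "H \<le> sqrt ((\<Sum>k<n. Re (\<sigma> k $ p $ p)) * (\<Sum>k<n. Re (\<sigma> k $ flip_bits p $ flip_bits p)))"
    for p
  proof -
    have "H = (\<Sum>k<n. sqrt (Re (\<sigma> k $ p $ p) * Re (\<sigma> k $ flip_bits p $ flip_bits p)))"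
      unfolding H_def by (intro sum.cong) (simp_all add: flip h)
    also have "\<dots> \<le> sqrt ((\<Sum>k<n. Re (\<sigma> k $ p $ p)) * (\<Sum>k<n. Re (\<sigma> k $ flip_bits p $ flip_bits p)))"
      by (intro sum_sqrt_mult_le) (simp_all add: nonneg)
    finally show ?thesis .
  qed
  have "H \<le> sqrt (a $ 1 * b $ 1)" "H \<le> sqrt (a $ 2 * b $ 2)" "H \<le> sqrt (a $ 3 * b $ 3)"
    "H \<le> sqrt (a $ 4 * b $ 4)"
    using pair[of "(0,0,0)"] pair[of "(0,0,1)"] pair[of "(0,1,0)"] pair[of "(0,1,1)"]
    unfolding a_sum b_sum by (simp_all add: flip_bits_def)
  moreover have "H \<le> root 4 (a $ 1 * b $ 2 * b $ 3 * a $ 4)"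
    "H \<le> root 4 (b $ 1 * a $ 2 * a $ 3 * b $ 4)"
    unfolding a_sum b_sum H_def by (intro sum_root4_le; simp add: nonneg h four)+
  ultimately have H_le: "H \<le> Delta a b"
    unfolding Delta_def by simp

  obtain \<theta> :: "real^4" and j :: int where \<theta>: "\<And>i. c $ i = rcis (cmod (c $ i)) (\<theta> $ i)"
    and \<phi>: "\<phi> = (\<theta> $ 1 + \<theta> $ 4) - (\<theta> $ 2 + \<theta> $ 3) + 2 * pi * of_int j"
    using assms(5) unfolding phase_difference_def by blast
  define \<eta> where "\<eta> k i = (if i = 1 then \<alpha> k + \<beta> k + \<gamma> k else if i = 2 then \<alpha> k + \<beta> k - \<gamma> k
    else if i = 3 then \<alpha> k - \<beta> k + \<gamma> k else \<alpha> k - \<beta> k - \<gamma> k)" for k and i :: 4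
  have c_sum: "c $ i = (\<Sum>k<n. rcis (h k) (\<eta> k i))" for i
    using exhaust_4[of i] anti[of "(0,0,0)"] anti[of "(0,0,1)"] anti[of "(0,1,0)"] anti[of "(0,1,1)"]
    by (elim disjE) (simp_all add: X_matrix_def bit_slot_def flip_bits_def \<eta>_def off)
  \<comment> \<open>Rotating \<open>c $ i\<close> by its own phase makes it real, so the modulus
    becomes linear in the summands.\<close>
  have mod_sum: "cmod (c $ i) = (\<Sum>k<n. h k * cos (\<eta> k i - \<theta> $ i))" for i
  proof -
    have "c $ i * cis (- \<theta> $ i) = cmod (c $ i)"
      by (subst \<theta>) (simp add: rcis_def cis_mult)
    then have "cmod (c $ i) = Re (c $ i * cis (- \<theta> $ i))"
      by simp
    also have "c $ i * cis (- \<theta> $ i) = (\<Sum>k<n. rcis (h k) (\<eta> k i - \<theta> $ i))"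
      unfolding c_sum by (simp add: sum_distrib_right rcis_def cis_mult mult.assoc)
    finally show ?thesis
      by simp
  qed
  obtain l m N where lm: "l \<ge> 0" "m \<ge> 0" "N > 0" "cos (angle_at Q P S) \<ge> 0"
    and N: "N\<^sup>2 = l\<^sup>2 + m\<^sup>2 + 2 * l * m * cos (angle_at Q P S)"
    and R: "l * dist P Q + m * dist P S = 2 * N * R"
    using acute_triangle_dual[OF assms(9,10)] .
  have "cos (angle_at Q P S) = cos (\<phi> / 2)"
    unfolding assms(8) by (rule cos_abs_real)
  then have cos_\<phi>: "cos \<phi> = 2 * (cos (angle_at Q P S))\<^sup>2 - 1"
    using cos_double_cos[of "\<phi> / 2"] by simp
  \<comment> \<open>Both side lengths are expanded over the summands, so the trigonometric bound
    applies to each one separately.\<close>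
  have "2 * N * R = (\<Sum>k<n. h k * (l * (cos (\<eta> k i1 - \<theta> $ i1) + cos (\<eta> k i2 - \<theta> $ i2))
      + m * (cos (\<eta> k i3 - \<theta> $ i3) + cos (\<eta> k i4 - \<theta> $ i4))))"
    unfolding R[symmetric] assms(6,7) mod_sum
    by (simp add: sum_distrib_left sum.distrib algebra_simps)
  also have "\<dots> \<le> (\<Sum>k<n. h k * (2 * N))"
  proof (intro sum_mono mult_left_mono cos_partition_bound)
    fix k
    \<comment> \<open>The phases of a product state cancel in this combination, leaving only the
      phase difference of c, negated and modulo 2 pi.\<close>
    have "(\<eta> k 1 - \<theta> $ 1) + (\<eta> k 4 - \<theta> $ 4) - (\<eta> k 2 - \<theta> $ 2) - (\<eta> k 3 - \<theta> $ 3)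
        = - (\<phi> - 2 * pi * of_int j)"
      unfolding \<phi> by (simp add: \<eta>_def)
    then have "cos ((\<eta> k 1 - \<theta> $ 1) + (\<eta> k 4 - \<theta> $ 4) - (\<eta> k 2 - \<theta> $ 2) - (\<eta> k 3 - \<theta> $ 3))
        = cos (\<phi> - 2 * pi * of_int j)"
      by (simp only: cos_minus)
    also have "\<dots> = cos \<phi>"
      by (simp add: cos_diff)
    finally show "cos ((\<eta> k 1 - \<theta> $ 1) + (\<eta> k 4 - \<theta> $ 4) - (\<eta> k 2 - \<theta> $ 2) - (\<eta> k 3 - \<theta> $ 3))
        = 2 * (cos (angle_at Q P S))\<^sup>2 - 1"
      unfolding cos_\<phi> .
  qed (use lm N h assms(3) in auto)
  also have "\<dots> = 2 * N * H"
    by (simp add: H_def sum_distrib_left mult_ac)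
  finally have "R \<le> H"
    using lm(3) by simp
  then show ?thesis
    using H_le by simp
qed

end
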